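(* For every integer $g>1$, $$V_{g-1}(5)=\begin{cases}2\cdot3^{g}\,5^{g/2}\,F_{g-1}, & g\text{ even},\\ 2\cdot3^{g}\,5^{(g-1)/2}\,(F_{g-2}+F_{g}), & g\text{ odd}.\end{cases}$$
   Context: For integers $n\ge1$, $m\ge3$, the $\mathrm{SU}(3)$ Verlinde sum is $$V_n(m)=3^nm^{2n}\sum_{\substack{(j,\ell,k)\in(\mathbb Z/m\mathbb Z\setminus\{0\})^3\\ j+\ell+k\equiv 0 \bmod m}}\Big(8\sin\frac{\pi j}{m}\sin\frac{\pi\ell}{m}\sin\frac{\pi k}{m}\Big)^{-2n}.$$ $F_n$ is the $n$th Fibonacci number ($F_1=F_2=1$, $F_{n+1}=F_n+F_{n-1}$). *)

theory Defs
  imports Complex_Main "HOL-Number_Theory.Fib"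
begin

text \<open>
  The nonzero classes of \<open>\<int>/m\<int>\<close> are represented by \<open>1, \<dots>, m - 1\<close>. Replacing a representative
  \<open>j\<close> by \<open>j + m\<close> changes the sign of \<open>sin (pi * j / m)\<close>, which the even exponent absorbs
  (see \<open>verlinde_term_cong\<close>).
\<close>

definition verlinde_index :: "nat \<Rightarrow> (int \<times> int \<times> int) set" where
  "verlinde_index m =
    {(j, l, k). j \<in> {1..<int m} \<and> l \<in> {1..<int m} \<and> k \<in> {1..<int m} \<and> int m dvd j + l + k}"

definition verlinde_term :: "nat \<Rightarrow> nat \<Rightarrow> int \<Rightarrow> int \<Rightarrow> int \<Rightarrow> real" where
  "verlinde_term n m j l k =
    (8 * sin (pi * of_int j / of_nat m) * sin (pi * of_int l / of_nat m)
       * sin (pi * of_int k / of_nat m)) powi (- 2 * int n)"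

definition verlinde_sum :: "nat \<Rightarrow> nat \<Rightarrow> real" where
  "verlinde_sum n m =
    3 ^ n * real m ^ (2 * n) * (\<Sum>(j, l, k)\<in>verlinde_index m. verlinde_term n m j l k)"

lemma finite_verlinde_index: "finite (verlinde_index m)"
  by (rule finite_subset[of _ "{1..<int m} \<times> {1..<int m} \<times> {1..<int m}"])
     (auto simp: verlinde_index_def)

lemma verlinde_term_cong:
  assumes m: "m > 0"
    and "j mod int m = j' mod int m" "l mod int m = l' mod int m" "k mod int m = k' mod int m"
  shows "verlinde_term n m j l k = verlinde_term n m j' l' k'"
proof -
  have sq: "(sin (pi * of_int a / of_nat m))\<^sup>2 = (sin (pi * of_int b / of_nat m))\<^sup>2"
    if "a mod int m = b mod int m" for a b :: int
  proof -
    from that have "int m dvd a - b"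
      by (simp add: mod_eq_dvd_iff)
    then obtain c where "a - b = int m * c" ..
    then have a: "a = b + int m * c"
      by simp
    have "cos (2 * (pi * of_int a / of_nat m)) =
        cos (2 * (pi * of_int b / of_nat m) + of_int c * (2 * pi))"
      using m by (simp add: a field_simps)
    also have "\<dots> = cos (2 * (pi * of_int b / of_nat m))"
      by (simp add: cos_add mult.commute[of "of_int c"])
    finally show ?thesis
      unfolding cos_double_sin by linarith
  qed
  have "x powi (- 2 * int n) = inverse ((x\<^sup>2) ^ n)" for x :: real
    using power_int_minus[of x "int (2 * n)"] by (simp only: power_int_of_nat power_mult) simp
  then show ?thesis
    unfolding verlinde_term_def by (simp only: power_mult_distrib sq[OF assms(2)] sq[OF assms(3)] sq[OF assms(4)])
qed

end

(* For m = 5 the terms of the sum take only two values: with a = sin^2 (pi/5), b = sin^2 (2 pi/5) and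
   a b = 5/16, the twelve admissible triples contribute six times (20 a)^-n and six times (20 b)^-n.
   After multiplication by 25^n these become (4 b)^n and (4 a)^n. Since 4 a and 4 b are the roots of
   t^2 - 5 t + 5, their power sums obey a linear recurrence, which Fibonacci numbers solve. *)
theory Submission
  imports Defs
begin

text \<open>Up to order, x and y are sqrt 5 times \<phi> and sqrt 5 times 1/\<phi>, with \<phi> the
  golden ratio. By Binet's formula odd powers therefore sum to Fibonacci numbers and even powers to
  Lucas numbers; this is the source of the two parity cases. The proof avoids radicals and uses only
  the recurrence.\<close>

lemma power_sum_roots_fib:
  fixes x y :: real
  assumes sum: "x + y = 5" and prod: "x * y = 5"
  shows "x ^ (2 * k + 1) + y ^ (2 * k + 1) = 5 ^ (k + 1) * real (fib (2 * k + 1))"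
    and "x ^ (2 * k + 2) + y ^ (2 * k + 2) =
      5 ^ (k + 1) * real (fib (2 * k + 1) + fib (2 * k + 3))"
proof -
  have rec: "x ^ (n + 2) + y ^ (n + 2) = 5 * (x ^ (n + 1) + y ^ (n + 1)) - 5 * (x ^ n + y ^ n)" for n
  proof -
    have "x ^ (n + 2) + y ^ (n + 2) = (x + y) * (x ^ (n + 1) + y ^ (n + 1)) - x * y * (x ^ n + y ^ n)"
      by (simp add: algebra_simps)
    then show ?thesis
      by (simp only: sum prod)
  qed
  \<comment> \<open>Both parities go through one induction, since each new power sum depends on the
    previous two.\<close>
  have "x ^ (2 * k + 1) + y ^ (2 * k + 1) = 5 ^ (k + 1) * real (fib (2 * k + 1)) \<and>
    x ^ (2 * k + 2) + y ^ (2 * k + 2) = 5 ^ (k + 1) * real (fib (2 * k + 1) + fib (2 * k + 3))"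
  proof (induction k)
    case 0
    then show ?case
      using rec[of 0] sum by (simp add: eval_nat_numeral)
  next
    case (Suc k)
    \<comment> \<open>The recurrence with step two, which stays within odd indices.\<close>
    have fib5: "real (fib (2 * k + 5)) = 3 * real (fib (2 * k + 3)) - real (fib (2 * k + 1))"
      by (simp add: eval_nat_numeral)
    have odd: "x ^ (2 * k + 3) + y ^ (2 * k + 3) = 5 ^ (k + 2) * real (fib (2 * k + 3))"
      using rec[of "2 * k + 1"] Suc.IH by (simp add: algebra_simps eval_nat_numeral)
    have "x ^ (2 * k + 4) + y ^ (2 * k + 4) =
        5 * (5 ^ (k + 2) * real (fib (2 * k + 3)))
          - 5 * (5 ^ (k + 1) * real (fib (2 * k + 1) + fib (2 * k + 3)))"
      using rec[of "2 * k + 2"] Suc.IH odd by (simp only: add.assoc) simp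
    also have "\<dots> = 5 ^ (k + 2) * real (fib (2 * k + 3) + fib (2 * k + 5))"
      by (simp only: of_nat_add fib5) (simp add: algebra_simps)
    finally have even: "x ^ (2 * k + 4) + y ^ (2 * k + 4) = \<dots>" .
    have "2 * Suc k + 1 = 2 * k + 3" "2 * Suc k + 2 = 2 * k + 4" "2 * Suc k + 3 = 2 * k + 5"
      "Suc k + 1 = k + 2"
      by simp_all
    with odd even show ?case
      by (simp only:)
  qed
  then show "x ^ (2 * k + 1) + y ^ (2 * k + 1) = 5 ^ (k + 1) * real (fib (2 * k + 1))"
    and "x ^ (2 * k + 2) + y ^ (2 * k + 2) =
      5 ^ (k + 1) * real (fib (2 * k + 1) + fib (2 * k + 3))"
    by simp_all
qed

text \<open>Doubling the angle acts on squared sines by t \<mapsto> 4 t (1 - t). It swaps a and b,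
  because sin (4 pi/5) = sin (pi/5).\<close>

lemma sin_squared_fifths:
  defines "a \<equiv> (sin (pi / 5))\<^sup>2" and "b \<equiv> (sin (2 * pi / 5))\<^sup>2"
  shows "a + b = 5 / 4" and "a * b = 5 / 16"
proof -
  have sin_sq_double: "(sin (2 * t))\<^sup>2 = 4 * (sin t)\<^sup>2 * (1 - (sin t)\<^sup>2)" for t :: real
    by (simp add: sin_double power_mult_distrib cos_squared_eq)
  have b: "b = 4 * a * (1 - a)"
    using sin_sq_double[of "pi / 5"] by (simp add: a_def b_def)
  have "sin (2 * (2 * pi / 5)) = sin (pi / 5)"
    using sin_pi_minus[of "pi / 5"] by (simp add: field_simps)
  then have a: "a = 4 * b * (1 - b)"
    using sin_sq_double[of "2 * pi / 5"] by (simp add: a_def b_def)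
  \<comment> \<open>The doubling relations also hold at the fixed points a = b = 0 and a = b = 3/4,
    so a \<noteq> b has to be secured before b - a can be cancelled.\<close>
  have "sin (pi / 5) < sin (2 * pi / 5)"
    by (rule sin_monotone_2pi) (use pi_gt_zero in linarith)+
  moreover have "0 < sin (pi / 5)"
    by (rule sin_gt_zero) auto
  ultimately have "a < b"
    unfolding a_def b_def by (intro power_strict_mono) auto
  have "(b - a) * (4 * (a + b) - 5) = (a - 4 * b * (1 - b)) - (b - 4 * a * (1 - a))"
    by (simp add: algebra_simps)
  also have "\<dots> = 0"
    by (simp only: a[symmetric] b[symmetric])
  finally show sum: "a + b = 5 / 4"
    using \<open>a < b\<close> by simp
  \<comment> \<open>This substitution replaces the square of a by the product a b, leaving b = 4 a b
    - a.\<close>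
  then have "1 - a = b - 1 / 4"
    by simp
  with b have "b = 4 * a * (b - 1 / 4)"
    by simp
  also have "\<dots> = 4 * (a * b) - a"
    by (simp add: algebra_simps)
  finally show "a * b = 5 / 16"
    using sum by linarith
qed

text \<open>The first row has two entries \<plusminus>1 and one entry \<plusminus>2 modulo 5, the
  second row one \<plusminus>1 and two \<plusminus>2. The squared sines thus multiply to a a b and a
  b b respectively.\<close>

lemma verlinde_index_5:
  "verlinde_index 5 =
    {(1, 1, 3), (1, 3, 1), (3, 1, 1), (4, 4, 2), (4, 2, 4), (2, 4, 4),
     (1, 2, 2), (2, 1, 2), (2, 2, 1), (4, 3, 3), (3, 4, 3), (3, 3, 4)}" (is "_ = ?S")
proof -
  have range: "x \<in> {1..<int 5} \<longleftrightarrow> x = 1 \<or> x = 2 \<or> x = 3 \<or> x = 4" for x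
    by auto
  have "(j, l, k) \<in> ?S" if "(j, l, k) \<in> verlinde_index 5" for j l k
  proof -
    from that have "j = 1 \<or> j = 2 \<or> j = 3 \<or> j = 4" "l = 1 \<or> l = 2 \<or> l = 3 \<or> l = 4"
      "k = 1 \<or> k = 2 \<or> k = 3 \<or> k = 4" "5 dvd j + l + k"
      unfolding verlinde_index_def by (simp_all only: mem_Collect_eq case_prod_conv range) simp
    then show ?thesis
      by (elim disjE) simp_all
  qed
  then have "verlinde_index 5 \<subseteq> ?S"
    by (metis prod_cases3 subsetI)
  moreover have "?S \<subseteq> verlinde_index 5"
    by (simp add: verlinde_index_def)
  ultimately show ?thesis
    by (rule subset_antisym)
qed

lemma verlinde_sum_5:
  "verlinde_sum n 5 =
    6 * 3 ^ n * ((4 * (sin (pi / 5))\<^sup>2) ^ n + (4 * (sin (2 * pi / 5))\<^sup>2) ^ n)"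
proof -
  define a where "a = (sin (pi / 5))\<^sup>2"
  define b where "b = (sin (2 * pi / 5))\<^sup>2"
  have sin_sq: "(sin (pi * 2 / 5))\<^sup>2 = b" "(sin (pi * 3 / 5))\<^sup>2 = b" "(sin (pi * 4 / 5))\<^sup>2 = a"
    using sin_pi_minus[of "2 * pi / 5"] sin_pi_minus[of "pi / 5"]
    by (simp_all add: a_def b_def field_simps)
  have prod: "a * b = 5 / 16"
    using sin_squared_fifths(2) by (simp add: a_def b_def)
  then have nz: "a \<noteq> 0" "b \<noteq> 0"
    by auto
  have powi: "(8 * p * q * r) powi (- 2 * int n) = inverse (64 * (p\<^sup>2 * q\<^sup>2 * r\<^sup>2)) ^ n"
    for p q r :: real
    using power_int_minus[of "8 * p * q * r" "int (2 * n)"]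
    by (simp only: power_int_of_nat power_mult power_inverse)
      (simp add: power_mult_distrib mult.assoc)
  \<comment> \<open>One pair a b is traded for 5/16, so that 64 times the product becomes 20 a or 20
    b.\<close>
  have triple: "a * a * b = 5 / 16 * a" "a * b * a = 5 / 16 * a" "b * a * a = 5 / 16 * a"
    "a * b * b = 5 / 16 * b" "b * a * b = 5 / 16 * b" "b * b * a = 5 / 16 * b"
    unfolding prod[symmetric] by (simp_all only: mult_ac)
  have "(\<Sum>(j, l, k)\<in>verlinde_index 5. verlinde_term n 5 j l k) =
      6 * (inverse (20 * a) ^ n + inverse (20 * b) ^ n)"
    unfolding verlinde_index_5 verlinde_term_def powi
    by (simp add: sin_sq triple flip: a_def del: inverse_mult_distrib)
  moreover have "25 * inverse (20 * a) = 4 * b" "25 * inverse (20 * b) = 4 * a"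
    using prod nz by (simp_all add: field_simps)
  then have "25 ^ n * inverse (20 * a) ^ n = (4 * b) ^ n"
    "25 ^ n * inverse (20 * b) ^ n = (4 * a) ^ n"
    by (simp_all only: flip: power_mult_distrib)
  moreover have "(5::real) ^ (2 * n) = 25 ^ n"
    by (simp add: power_mult)
  ultimately show ?thesis
    unfolding verlinde_sum_def a_def[symmetric] b_def[symmetric]
    by (simp add: algebra_simps)
qed

theorem mainTheorem6:
  fixes g :: nat
  assumes "g > 1"
  shows "verlinde_sum (g - 1) 5 =
    (if even g then 2 * 3 ^ g * 5 ^ (g div 2) * real (fib (g - 1))
     else 2 * 3 ^ g * 5 ^ ((g - 1) div 2) * real (fib (g - 2) + fib g))"
proof -
  define x y where "x = 4 * (sin (pi / 5))\<^sup>2" and "y = 4 * (sin (2 * pi / 5))\<^sup>2"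
  have "x + y = 5" "x * y = 5"
    using sin_squared_fifths by (simp_all add: x_def y_def)
  note pow = power_sum_roots_fib[OF this]
  \<comment> \<open>Turns the prefactor 6 * 3^(g - 1) into 2 * 3^g.\<close>
  have "(3::real) ^ g = 3 * 3 ^ (g - 1)"
    using assms by (simp flip: power_Suc)
  then have V: "verlinde_sum (g - 1) 5 = 2 * 3 ^ g * (x ^ (g - 1) + y ^ (g - 1))"
    by (simp add: verlinde_sum_5 x_def y_def)
  show ?thesis
  proof (cases "even g")
    case True
    \<comment> \<open>In both cases g > 1 gives g div 2 \<ge> 1, so the truncated subtraction in the
      witness is exact.\<close>
    with assms obtain k where "g = 2 * k + 2"
      by (intro that[of "g div 2 - 1"]) auto
    then have "g - 1 = 2 * k + 1" "g div 2 = k + 1"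
      by simp_all
    with True show ?thesis
      unfolding V by (simp only: if_True pow mult.assoc)
  next
    case False
    with assms obtain k where "g = 2 * k + 3"
      by (intro that[of "g div 2 - 1"]) presburger
    then have "g - 1 = 2 * k + 2" "(g - 1) div 2 = k + 1" "g - 2 = 2 * k + 1" "fib g = fib (2 * k + 3)"
      by simp_all
    with False show ?thesis
      unfolding V by (simp only: if_False pow mult.assoc)
  qed
qed

end
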